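(* Let $\mathbf{A}\in\mathbb{R}^{n\times n}$, $\mathbf{b}\in\mathbb{R}^n$, let $\mathbf{x}^*\in\mathbb{R}^n$ be the exact solution of $\mathbf{A}\mathbf{x}=\mathbf{b}$, and let $q(\mathbf{x})=\mathbf{M}\mathbf{x}+\mathbf{b}$ with $\mathbf{M}=\mathbf{I}-\mathbf{A}$. Let $t\ge 0$ be an integer and $p=t+1$. Let $\{\mathbf{x}_k\}$ be the iterates of the aAA($\infty$)[$1$]--FP[$t$] method applied to the fixed-point iteration $\mathbf{x}_{k+1}=q(\mathbf{x}_k)$ from the initial guess $\mathbf{x}_0$, and let $\mathbf{x}_k^G$ be the $k$th iterate of GMRES applied to $\mathbf{A}\mathbf{x}=\mathbf{b}$ with the same initial guess $\mathbf{x}_0^G=\mathbf{x}_0$. Assume that there is a $k_0$ such that the norms of the GMRES residuals are strictly decreasing over the first $k_0$ iterations, i.e. $\|\mathbf{b}-\mathbf{A}\mathbf{x}_k^G\|<\|\mathbf{b}-\mathbf{A}\mathbf{x}_{k-1}^G\|$ for $1\le k\le k_0$. Then $$\mathbf{x}_{jp}=q(\mathbf{x}_{jp-1}^G)\qquad\text{for all integers } j\ge 1 \text{ with } jp<k_0 .$$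
   Context: $\|\cdot\|$ is the Euclidean norm. The residual function is $r(\mathbf{x})=q(\mathbf{x})-\mathbf{x}=\mathbf{b}-\mathbf{A}\mathbf{x}$. Anderson step: given $\mathbf{x}_0,\dots,\mathbf{x}_k$ and a window size $m\in\{0,1,2,\dots\}\cup\{\infty\}$, put $m_k=\min\{m,k\}$. The AA($m$) update is $$\mathbf{x}_{k+1}=q(\mathbf{x}_k)+\sum_{i=1}^{m_k}\gamma_i^{(k)}\bigl(q(\mathbf{x}_k)-q(\mathbf{x}_{k-i})\bigr),$$ where $(\gamma_1^{(k)},\dots,\gamma_{m_k}^{(k)})\in\mathbb{R}^{m_k}$ minimizes $\bigl\|r(\mathbf{x}_k)+\sum_{i=1}^{m_k}\gamma_i\,(r(\mathbf{x}_k)-r(\mathbf{x}_{k-i}))\bigr\|^2$. The method aAA($m$)[$s$]--FP[$t$] (integers $s\ge1$, $t\ge0$) starts from $\mathbf{x}_0$, and for each $k\ge 0$: if $k \bmod (s+t)<t$, then $\mathbf{x}_{k+1}=q(\mathbf{x}_k)$ (fixed-point step); otherwise $\mathbf{x}_{k+1}$ is the AA($m$) update. Thus it repeats $t$ fixed-point steps followed by $s$ Anderson steps; the history used by an Anderson step consists of all preceding iterates within the window, whether produced by fixed-point or Anderson steps. With $m=\infty$, $m_k=k$ (all previous iterates are used). GMRES: $\mathbf{x}_k^G$ is the minimizer of $\|\mathbf{b}-\mathbf{A}\mathbf{x}\|$ over $\mathbf{x}\in \mathbf{x}_0+\mathrm{span}\{\mathbf{r}_0,\mathbf{A}\mathbf{r}_0,\dots,\mathbf{A}^{k-1}\mathbf{r}_0\}$,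 $\mathbf{r}_0=\mathbf{b}-\mathbf{A}\mathbf{x}_0$. *)

theory Defs
  imports "HOL-Analysis.Analysis" "HOL-Library.Extended_Nat"
begin

definition residual :: "('a \<Rightarrow> 'a) \<Rightarrow> 'a \<Rightarrow> 'a::real_normed_vector" where
  "residual q x = q x - x"

definition window :: "enat \<Rightarrow> nat \<Rightarrow> nat" where
  "window m k = the_enat (min m (enat k))"

(* Coefficient vectors are functions on the naturals of which only the entries
   1, ..., window m k matter.  The least-squares problem always has a minimizer, but it need
   not be unique, so the Anderson step is a relation: y may come from any minimizer. *)
definition anderson_step ::
    "('a \<Rightarrow> 'a) \<Rightarrow> enat \<Rightarrow> (nat \<Rightarrow> 'a) \<Rightarrow> nat \<Rightarrow> 'a::real_normed_vector \<Rightarrow> bool" where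
  "anderson_step q m x k y \<longleftrightarrow>
     (\<exists>\<gamma> :: nat \<Rightarrow> real.
        is_arg_min
          (\<lambda>\<gamma>. (norm (residual q (x k)
             + (\<Sum>i = 1..window m k. \<gamma> i *\<^sub>R (residual q (x k) - residual q (x (k - i))))))\<^sup>2)
          (\<lambda>_. True) \<gamma>
      \<and> y = q (x k) + (\<Sum>i = 1..window m k. \<gamma> i *\<^sub>R (q (x k) - q (x (k - i)))))"

(* x is a sequence of iterates of aAA(m)[s]--FP[t] for q; intended for s \<ge> 1. *)
definition aAA_FP_iterates ::
    "('a \<Rightarrow> 'a) \<Rightarrow> enat \<Rightarrow> nat \<Rightarrow> nat \<Rightarrow> 'a \<Rightarrow> (nat \<Rightarrow> 'a::real_normed_vector) \<Rightarrow> bool" where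
  "aAA_FP_iterates q m s t x0 x \<longleftrightarrow>
     x 0 = x0 \<and>
     (\<forall>k. if k mod (s + t) < t then x (Suc k) = q (x k)
          else anderson_step q m x k (x (Suc k)))"

definition krylov :: "real^'n^'n \<Rightarrow> real^'n \<Rightarrow> nat \<Rightarrow> (real^'n) set" where
  "krylov A r k = span ((\<lambda>i. (((*v) A) ^^ i) r) ` {..<k})"

(* For singular A the minimizer may fail to be unique; x k is then any minimizer.
   At k = 0 the search set is {x0}, so x 0 = x0. *)
definition gmres_iterates ::
    "real^'n^'n \<Rightarrow> real^'n \<Rightarrow> real^'n \<Rightarrow> (nat \<Rightarrow> real^'n) \<Rightarrow> bool" where
  "gmres_iterates A b x0 x \<longleftrightarrow>
     (\<forall>k. is_arg_min (\<lambda>y. norm (b - A *v y))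
            (\<lambda>y. y \<in> {x0 + z | z. z \<in> krylov A (b - A *v x0) k}) (x k))"

end

(* GMRES minimizes the residual over the affine space x0 + K_k with K_k a Krylov space, an Anderson
   step with unlimited window minimizes it over the affine hull of x_0, ..., x_k and then applies q.
   So everything reduces to showing that this affine hull is x0 + K_k and that the minimizer is
   unique.  Strict decrease of the GMRES residuals says that A (A^k r0) is not in A K_k for k < k0.
   This makes A injective on the Krylov spaces (A itself may be singular), and it shows that q maps
   a point of x0 + K_k outside x0 + K_(k-1) to a point of x0 + K_(k+1) outside x0 + K_k, so every
   new iterate enlarges the affine hull by one dimension.  The last fact also applies after an
   Anderson step, because the k-th GMRES iterate lies outside x0 + K_(k-1). *)
theory Submission
  imports Defs
begin

section \<open>Krylov spaces\<close>

lemma krylov_0 [simp]: "krylov A r 0 = {0}"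
  by (simp add: krylov_def)

lemma subspace_krylov: "subspace (krylov A r k)"
  by (simp add: krylov_def)

lemma krylov_mono: "i \<le> k \<Longrightarrow> krylov A r i \<subseteq> krylov A r k"
  unfolding krylov_def by (intro span_mono image_mono) auto

lemma krylov_power: "i < k \<Longrightarrow> (((*v) A) ^^ i) r \<in> krylov A r k"
  unfolding krylov_def by (rule span_base) auto

lemma krylov_SucE:
  assumes "z \<in> krylov A r (Suc k)"
  obtains c z' where "z' \<in> krylov A r k" "z = z' + c *\<^sub>R (((*v) A) ^^ k) r"
proof -
  obtain c where "z - c *\<^sub>R (((*v) A) ^^ k) r \<in> krylov A r k"
    using assms unfolding krylov_def
    by (auto simp add: lessThan_Suc span_breakdown_eq)
  then show ?thesis
    using that[of "z - c *\<^sub>R (((*v) A) ^^ k) r" c] by simp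
qed

lemma krylov_mult:
  assumes "z \<in> krylov A r k"
  shows "A *v z \<in> krylov A r (Suc k)"
proof -
  have "A *v z \<in> ((*v) A) ` span ((\<lambda>i. (((*v) A) ^^ i) r) ` {..<k})"
    using assms by (simp add: krylov_def)
  also have "\<dots> = span ((*v) A ` (\<lambda>i. (((*v) A) ^^ i) r) ` {..<k})"
    by (rule linear_span_image[symmetric]) simp
  also have "\<dots> \<subseteq> krylov A r (Suc k)"
    unfolding krylov_def
  proof (intro span_mono subsetI)
    fix w assume "w \<in> (*v) A ` (\<lambda>i. (((*v) A) ^^ i) r) ` {..<k}"
    then obtain i where "i < k" "w = (((*v) A) ^^ Suc i) r"
      by auto
    then show "w \<in> (\<lambda>i. (((*v) A) ^^ i) r) ` {..<Suc k}"
      by blast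
  qed
  finally show ?thesis .
qed

text \<open>A triangular change of generators: \<open>d (Suc i)\<close> has a nonzero component
  along the \<open>i\<close>-th power of \<open>A\<close> applied to \<open>r\<close>, so dividing
  by it recovers that power from \<open>d (Suc i)\<close> and the smaller Krylov space. Index 0 is
  left out because \<open>d 0\<close> is zero.\<close>

lemma krylov_subset_span:
  assumes "\<And>i. i \<le> k \<Longrightarrow> d i \<in> krylov A r i"
    and "\<And>i. i < k \<Longrightarrow> d (Suc i) \<notin> krylov A r i"
  shows "krylov A r k \<subseteq> span (d ` {1..k})"
  using assms
proof (induction k)
  case 0
  then show ?case by simp
next
  case (Suc k)
  have "krylov A r k \<subseteq> span (d ` {1..k})"
    by (rule Suc.IH) (use Suc.prems in auto)
  also have "\<dots> \<subseteq> span (d ` {1..Suc k})"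
    by (intro span_mono image_mono) auto
  finally have IH: "krylov A r k \<subseteq> span (d ` {1..Suc k})" .
  let ?v = "(((*v) A) ^^ k) r"
  obtain c z where z: "z \<in> krylov A r k" "d (Suc k) = z + c *\<^sub>R ?v"
    using Suc.prems(1)[of "Suc k"] krylov_SucE by blast
  have "c \<noteq> 0"
    using z Suc.prems(2)[of k] by auto
  then have "?v = (1 / c) *\<^sub>R (d (Suc k) - z)"
    using z(2) by simp
  moreover have "d (Suc k) \<in> span (d ` {1..Suc k})"
    by (rule span_base) auto
  ultimately have v: "?v \<in> span (d ` {1..Suc k})"
    using IH z(1) by (auto intro!: span_scale span_diff)
  show ?case
  proof
    fix w assume "w \<in> krylov A r (Suc k)"
    then obtain c' z' where "z' \<in> krylov A r k" "w = z' + c' *\<^sub>R ?v"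
      using krylov_SucE by blast
    then show "w \<in> span (d ` {1..Suc k})"
      using IH v by (auto intro!: span_scale span_add)
  qed
qed

text \<open>Coefficients belong to indices rather than to vectors, as in the Anderson sum, so
  \<open>v\<close> may repeat values on \<open>S\<close>.\<close>

lemma span_image_finiteE:
  assumes "finite S" "w \<in> span (v ` S)"
  obtains g :: "_ \<Rightarrow> real" where "w = (\<Sum>i\<in>S. g i *\<^sub>R v i)"
  using assms
proof (induction S arbitrary: w thesis rule: finite_induct)
  case empty
  then show ?case by simp
next
  case (insert a S)
  obtain c where "w - c *\<^sub>R v a \<in> span (v ` S)"
    using insert.prems(2) by (auto simp add: span_breakdown_eq)
  then obtain g where g: "w - c *\<^sub>R v a = (\<Sum>i\<in>S. g i *\<^sub>R v i)"
    using insert.IH by blast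
  have "(\<Sum>i\<in>S. (g(a := c)) i *\<^sub>R v i) = (\<Sum>i\<in>S. g i *\<^sub>R v i)"
    using insert.hyps(2) by (intro sum.cong) auto
  then have "w = (\<Sum>i\<in>insert a S. (g(a := c)) i *\<^sub>R v i)"
    using g insert.hyps by (simp add: algebra_simps)
  then show ?case by (rule insert.prems(1))
qed

section \<open>GMRES with strictly decreasing residuals\<close>

text \<open>Strict convexity of the norm, by the parallelogram law. It makes the minimal residual
  unique.\<close>

lemma norm_midpoint_less:
  fixes u v :: "'a::real_inner"
  assumes "norm u = norm v" "u \<noteq> v"
  shows "norm ((1/2) *\<^sub>R (u + v)) < norm u"
proof -
  have "(norm (u + v))\<^sup>2 + (norm (u - v))\<^sup>2 = 2 * (norm u)\<^sup>2 + 2 * (norm v)\<^sup>2"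
    by (simp add: power2_norm_eq_inner inner_simps inner_commute)
  moreover have "(norm (u - v))\<^sup>2 > 0"
    using assms(2) by simp
  moreover have "(2 * norm u)\<^sup>2 = 2 * (norm u)\<^sup>2 + 2 * (norm v)\<^sup>2"
    using assms(1) by (simp add: power_mult_distrib)
  ultimately have "(norm (u + v))\<^sup>2 < (2 * norm u)\<^sup>2"
    by linarith
  then have "norm (u + v) < 2 * norm u"
    by (rule power2_less_imp_less) simp
  then show ?thesis by simp
qed

locale gmres_decreasing =
  fixes A :: "real^'n^'n" and b x0 :: "real^'n" and xG :: "nat \<Rightarrow> real^'n" and k0 :: nat
  assumes gmres: "gmres_iterates A b x0 xG"
    and decr: "\<And>k. k < k0 \<Longrightarrow> norm (b - A *v xG (Suc k)) < norm (b - A *v xG k)"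
begin

abbreviation r0 :: "real^'n" where "r0 \<equiv> b - A *v x0"
abbreviation K :: "nat \<Rightarrow> (real^'n) set" where "K \<equiv> krylov A r0"

lemma gmres_in: "xG k - x0 \<in> K k"
proof -
  have "xG k \<in> {x0 + z | z. z \<in> K k}"
    using gmres unfolding gmres_iterates_def is_arg_min_def by blast
  then show ?thesis by auto
qed

lemma gmres_le:
  assumes "y - x0 \<in> K k"
  shows "norm (b - A *v xG k) \<le> norm (b - A *v y)"
proof -
  have "y = x0 + (y - x0)"
    by simp
  with assms have "y \<in> {x0 + z | z. z \<in> K k}"
    by blast
  with gmres show ?thesis
    unfolding gmres_iterates_def is_arg_min_def by (meson not_le)
qed

text \<open>Otherwise this iterate would already compete in the minimization defining
  \<open>xG k\<close>, against strict decrease.\<close>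

lemma gmres_notin:
  assumes "k < k0"
  shows "xG (Suc k) - x0 \<notin> K k"
  using gmres_le decr[OF assms] by fastforce

text \<open>If some \<open>u\<close> in \<open>K k\<close> had the same image under \<open>A\<close>
  as the new power, putting \<open>u\<close> in its place in \<open>xG (Suc k)\<close> would give a
  point of \<open>x0 + K k\<close> with the same residual, so the norm could not have dropped at
  this step.\<close>

lemma mult_power_notin:
  assumes "k < k0"
  shows "A *v (((*v) A) ^^ k) r0 \<notin> (*v) A ` K k"
proof
  assume "A *v (((*v) A) ^^ k) r0 \<in> (*v) A ` K k"
  then obtain u where u: "u \<in> K k" "A *v (((*v) A) ^^ k) r0 = A *v u"
    by auto
  obtain c z where z: "z \<in> K k" "xG (Suc k) - x0 = z + c *\<^sub>R (((*v) A) ^^ k) r0"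
    using gmres_in krylov_SucE by blast
  define y where "y = x0 + (z + c *\<^sub>R u)"
  have "xG (Suc k) = x0 + (z + c *\<^sub>R (((*v) A) ^^ k) r0)"
    using z(2) by (simp add: algebra_simps)
  then have "A *v xG (Suc k) = A *v y"
    by (simp add: y_def u(2) matrix_vector_right_distrib matrix_vector_mult_scaleR)
  moreover have "y - x0 \<in> K k"
    using u z by (simp add: y_def subspace_krylov subspace_add subspace_scale)
  ultimately show False
    using gmres_le[of y k] decr[OF assms] by simp
qed

text \<open>Stands in for invertibility of \<open>A\<close>. In a kernel vector, a nonzero
  coefficient of the highest power could be divided out, which \<open>mult_power_notin\<close>
  forbids; induction handles the rest.\<close>

lemma krylov_kernel:
  assumes "k \<le> k0" "z \<in> K k" "A *v z = 0"
  shows "z = 0"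
  using assms
proof (induction k)
  case 0
  then show ?case by simp
next
  case (Suc k)
  let ?v = "(((*v) A) ^^ k) r0"
  obtain c z' where z': "z' \<in> K k" "z = z' + c *\<^sub>R ?v"
    using Suc.prems(2) krylov_SucE by blast
  have "c = 0"
  proof (rule ccontr)
    assume "c \<noteq> 0"
    then have "?v = (1 / c) *\<^sub>R (z - z')"
      using z'(2) by simp
    also have "A *v \<dots> = (1 / c) *\<^sub>R (A *v z - A *v z')"
      by (simp only: matrix_vector_mult_scaleR matrix_vector_mult_diff_distrib)
    also have "\<dots> = (- 1 / c) *\<^sub>R (A *v z')"
      using Suc.prems(3) by simp
    also have "\<dots> = A *v ((- 1 / c) *\<^sub>R z')"
      by (simp only: matrix_vector_mult_scaleR)
    finally have "A *v ?v \<in> (*v) A ` K k"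
      using z'(1) subspace_krylov subspace_scale by blast
    then show False
      using mult_power_notin Suc.prems(1) by simp
  qed
  with z' Suc show ?case by simp
qed

text \<open>Two minimizers with different residuals would be beaten by their midpoint. Hence the
  residuals agree, and injectivity of \<open>A\<close> on \<open>K k\<close> makes the points
  agree.\<close>

lemma gmres_unique:
  assumes "k \<le> k0" "y - x0 \<in> K k"
    and "norm (b - A *v y) \<le> norm (b - A *v xG k)"
  shows "y = xG k"
proof -
  let ?m = "(1/2) *\<^sub>R (y + xG k)"
  have "?m - x0 = (1/2) *\<^sub>R (y - x0 + (xG k - x0))"
    by (simp add: vec_eq_iff field_simps)
  also have "\<dots> \<in> K k"
    by (intro subspace_scale[OF subspace_krylov] subspace_add[OF subspace_krylov]
        assms(2) gmres_in)
  finally have "?m - x0 \<in> K k" .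
  then have "norm (b - A *v xG k) \<le> norm (b - A *v ?m)"
    by (rule gmres_le)
  moreover have "b - A *v ?m = (1/2) *\<^sub>R ((b - A *v y) + (b - A *v xG k))"
    by (simp add: matrix_vector_right_distrib matrix_vector_mult_scaleR vec_eq_iff field_simps)
  moreover have "norm (b - A *v y) = norm (b - A *v xG k)"
    using assms(3) gmres_le[OF assms(2)] by simp
  ultimately have "b - A *v y = b - A *v xG k"
    using norm_midpoint_less[of "b - A *v y" "b - A *v xG k"] by fastforce
  then have "A *v (y - xG k) = 0"
    by (simp add: matrix_vector_mult_diff_distrib)
  moreover have "y - xG k \<in> K k"
    using subspace_diff[OF subspace_krylov assms(2) gmres_in] by simp
  ultimately show ?thesis
    using krylov_kernel[OF assms(1)] by fastforce
qed

section \<open>The iterates of the alternating method\<close>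

definition q :: "real^'n \<Rightarrow> real^'n" where
  "q y = (mat 1 - A) *v y + b"

lemma q_eq: "q y = y + (b - A *v y)"
  by (simp add: q_def matrix_vector_mult_diff_rdistrib)

lemma residual_q: "residual q y = b - A *v y"
  by (simp add: residual_def q_eq)

(* For k = 0 the truncated K (k - 1) is K 0, hence the disjunction. *)
lemma q_fresh:
  assumes "k < k0" "y - x0 \<in> K k" "k = 0 \<or> y - x0 \<notin> K (k - 1)"
  shows "q y - x0 \<in> K (Suc k) \<and> q y - x0 \<notin> K k"
proof
  have eq: "q y - x0 = (y - x0) + r0 - A *v (y - x0)"
    by (simp add: q_eq matrix_vector_mult_diff_distrib)
  have y: "y - x0 \<in> K (Suc k)"
    using assms(2) krylov_mono[of k "Suc k"] by auto
  have "r0 \<in> K (Suc k)"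
    using krylov_power[of 0 "Suc k"] by simp
  then have "(y - x0) + r0 \<in> K (Suc k)"
    by (rule subspace_add[OF subspace_krylov y])
  then show "q y - x0 \<in> K (Suc k)"
    unfolding eq by (rule subspace_diff[OF subspace_krylov _ krylov_mult[OF assms(2)]])
  have notin: "(((*v) A) ^^ k) r0 \<notin> K k"
    using mult_power_notin[OF assms(1)] by auto
  show "q y - x0 \<notin> K k"
  proof
    assume *: "q y - x0 \<in> K k"
    show False
    proof (cases k)
      case 0
      \<comment> \<open>Since \<open>K 0\<close> is zero, \<open>y = x0\<close>, and
        \<open>q y - x0\<close> is \<open>r0\<close>, the zeroth power itself.\<close>
      with * assms(2) notin eq show False by simp
    next
      case (Suc l)
      let ?v = "(((*v) A) ^^ l) r0"
      obtain c z where z: "z \<in> K l" "y - x0 = z + c *\<^sub>R ?v"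
        using assms(2) krylov_SucE unfolding Suc by blast
      have "c \<noteq> 0"
        using assms(3) z Suc by auto
      have r0: "r0 \<in> K k"
        using krylov_power[of 0 k] Suc by simp
      \<comment> \<open>Applying \<open>A\<close> turns the top term of \<open>y - x0\<close> into
        \<open>c\<close> times the \<open>k\<close>-th power, while \<open>A *v z\<close> stays in
        \<open>K k\<close>. Solving for that power would place it in \<open>K k\<close>.\<close>
      have "A *v (y - x0) = A *v z + c *\<^sub>R (((*v) A) ^^ k) r0"
        by (simp add: z(2) Suc matrix_vector_right_distrib matrix_vector_mult_scaleR)
      then have "c *\<^sub>R (((*v) A) ^^ k) r0 = (y - x0) + r0 - (q y - x0) - A *v z"
        unfolding eq by (simp add: algebra_simps)
      also have "\<dots> \<in> K k"
        using subspace_diff[OF subspace_krylov subspace_diff[OF subspace_krylov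
              subspace_add[OF subspace_krylov assms(2) r0] *]] krylov_mult[OF z(1)] Suc
        by simp
      finally have "(1 / c) *\<^sub>R (c *\<^sub>R (((*v) A) ^^ k) r0) \<in> K k"
        by (rule subspace_scale[OF subspace_krylov])
      with \<open>c \<noteq> 0\<close> notin show False by simp
    qed
  qed
qed

text \<open>The weights of \<open>x k\<close> and of the earlier iterates in
  \<open>Y k \<gamma>\<close> sum to 1, and affine maps such as the residual and \<open>q\<close>
  commute with such combinations. An Anderson step therefore minimizes the residual at
  \<open>Y k \<gamma>\<close> and then applies \<open>q\<close>.\<close>

lemma affine_combination:
  fixes x :: "nat \<Rightarrow> real^'n"
  defines "Y \<equiv> \<lambda>k \<gamma>. x k + (\<Sum>i = 1..k. \<gamma> i *\<^sub>R (x k - x (k - i)))"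
  shows "residual q (x k) + (\<Sum>i = 1..k. \<gamma> i *\<^sub>R (residual q (x k) - residual q (x (k - i))))
           = b - A *v Y k \<gamma>" (is ?R)
    and "q (x k) + (\<Sum>i = 1..k. \<gamma> i *\<^sub>R (q (x k) - q (x (k - i)))) = q (Y k \<gamma>)" (is ?Q)
proof -
  have A: "A *v (\<Sum>i = 1..k. \<gamma> i *\<^sub>R (x k - x (k - i)))
      = (\<Sum>i = 1..k. \<gamma> i *\<^sub>R (A *v x k - A *v x (k - i)))"
    by (simp add: linear_sum[OF matrix_vector_mul_linear] matrix_vector_mult_scaleR
        matrix_vector_mult_diff_distrib)
  have "(\<Sum>i = 1..k. \<gamma> i *\<^sub>R (residual q (x k) - residual q (x (k - i))))
      = - (\<Sum>i = 1..k. \<gamma> i *\<^sub>R (A *v x k - A *v x (k - i)))"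
    unfolding residual_q sum_negf[symmetric]
    by (intro sum.cong) (auto simp: algebra_simps)
  then show R: ?R
    unfolding Y_def matrix_vector_right_distrib A by (simp add: residual_q)
  have "q z = z + residual q z" for z
    by (simp add: residual_def)
  then have "q (x k) + (\<Sum>i = 1..k. \<gamma> i *\<^sub>R (q (x k) - q (x (k - i)))) = Y k \<gamma>
    + (residual q (x k) + (\<Sum>i = 1..k. \<gamma> i *\<^sub>R (residual q (x k) - residual q (x (k - i)))))"
    unfolding Y_def residual_def by (simp add: algebra_simps sum.distrib sum_subtractf)
  then show ?Q
    unfolding R q_eq .
qed

text \<open>The induction invariant: the differences from \<open>x0\<close> form a basis adapted to
  the flag of Krylov spaces. The case \<open>i = 0\<close> encodes \<open>x 0 = x0\<close>.\<close>

definition krylov_adapted :: "(nat \<Rightarrow> real^'n) \<Rightarrow> nat \<Rightarrow> bool" where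
  "krylov_adapted x k \<longleftrightarrow>
     (\<forall>i\<le>k. x i - x0 \<in> K i) \<and> (\<forall>i<k. x (Suc i) - x0 \<notin> K i)"

text \<open>By \<open>krylov_subset_span\<close> the differences from \<open>x0\<close> generate
  \<open>K k\<close>. As \<open>x0\<close> is itself the iterate \<open>x 0\<close>, the base point
  can be moved from \<open>x0\<close> to \<open>x k\<close>.\<close>

lemma krylov_adapted_combination:
  assumes "krylov_adapted x k" "y - x0 \<in> K k"
  obtains \<gamma> where "y = x k + (\<Sum>i = 1..k. \<gamma> i *\<^sub>R (x k - x (k - i)))"
proof -
  let ?V = "span ((\<lambda>i. x k - x (k - i)) ` {1..k})"
  have 0: "x 0 = x0"
    using assms(1) by (auto simp: krylov_adapted_def)
  have V: "x k - x i \<in> ?V" if "i \<le> k" for i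
  proof (cases "i = k")
    case False
    \<comment> \<open>The Anderson sum counts backwards from \<open>k\<close>, so iterate
      \<open>i\<close> appears at index \<open>k - i\<close>.\<close>
    then have "k - i \<in> {1..k}" "x k - x i = x k - x (k - (k - i))"
      using that by auto
    then show ?thesis by (intro span_base) blast
  qed (simp add: span_zero)
  have d: "x i - x0 \<in> ?V" if "i \<le> k" for i
  proof -
    have "x i - x0 = (x k - x 0) - (x k - x i)"
      by (simp add: 0)
    also have "\<dots> \<in> ?V"
      using that by (intro span_diff V) auto
    finally show ?thesis .
  qed
  have "K k \<subseteq> span ((\<lambda>i. x i - x0) ` {1..k})"
    using assms(1) unfolding krylov_adapted_def by (intro krylov_subset_span) auto
  also have "\<dots> \<subseteq> ?V"
    using d by (intro span_minimal subspace_span) auto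
  finally have "(y - x0) - (x k - x0) \<in> ?V"
    using assms(2) by (intro span_diff[OF _ d]) auto
  then obtain \<gamma> where "(y - x0) - (x k - x0) = (\<Sum>i = 1..k. \<gamma> i *\<^sub>R (x k - x (k - i)))"
    by (rule span_image_finiteE[rotated]) auto
  then show thesis
    using that[of \<gamma>] by (simp add: algebra_simps)
qed

text \<open>The coefficients matter only through the point \<open>Y \<gamma>\<close>. It lies in
  \<open>x0 + K k\<close>, and \<open>xG k\<close> is among the points it competes with, so
  \<open>gmres_unique\<close> identifies the two.\<close>

lemma anderson_step_gmres:
  assumes "krylov_adapted x k" "k \<le> k0" "anderson_step q \<infinity> x k y"
  shows "y = q (xG k)"
proof -
  define Y where "Y = (\<lambda>\<gamma>. x k + (\<Sum>i = 1..k. \<gamma> i *\<^sub>R (x k - x (k - i))))"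
  have win: "window \<infinity> k = k"
    by (simp add: window_def)
  obtain \<gamma> where \<gamma>: "is_arg_min (\<lambda>\<gamma>. (norm (b - A *v Y \<gamma>))\<^sup>2) (\<lambda>_. True) \<gamma>" "y = q (Y \<gamma>)"
    using assms(3) unfolding anderson_step_def win affine_combination Y_def by blast
  have mem: "x i - x0 \<in> K k" if "i \<le> k" for i
    using assms(1) that krylov_mono[OF that] unfolding krylov_adapted_def by blast
  have "x k - x (k - i) \<in> K k" for i
    using subspace_diff[OF subspace_krylov mem[of k] mem[of "k - i"]] by simp
  then have "(x k - x0) + (\<Sum>i = 1..k. \<gamma> i *\<^sub>R (x k - x (k - i))) \<in> K k"
    by (intro subspace_add subspace_krylov subspace_sum subspace_scale mem) auto
  then have "Y \<gamma> - x0 \<in> K k"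
    by (simp add: Y_def algebra_simps)
  moreover obtain \<gamma>' where "xG k = Y \<gamma>'"
    using krylov_adapted_combination[OF assms(1) gmres_in] unfolding Y_def by blast
  then have "(norm (b - A *v Y \<gamma>))\<^sup>2 \<le> (norm (b - A *v xG k))\<^sup>2"
    using \<gamma>(1) unfolding is_arg_min_def by (auto simp: not_less)
  then have "norm (b - A *v Y \<gamma>) \<le> norm (b - A *v xG k)"
    by (rule power2_le_imp_le) simp
  ultimately have "Y \<gamma> = xG k"
    by (rule gmres_unique[OF assms(2)])
  with \<gamma>(2) show ?thesis by simp
qed

text \<open>Either kind of step applies \<open>q\<close> to a point that is new at level
  \<open>k\<close>: \<open>x k\<close> itself by the invariant, or \<open>xG k\<close> by
  \<open>gmres_notin\<close> at \<open>k - 1\<close>. Then \<open>q_fresh\<close> extends the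
  invariant.\<close>

lemma iterates_krylov_adapted:
  assumes "aAA_FP_iterates q \<infinity> 1 t x0 x" "k \<le> k0"
  shows "krylov_adapted x k"
  using assms(2)
proof (induction k)
  case 0
  then show ?case
    using assms(1) by (simp add: krylov_adapted_def aAA_FP_iterates_def)
next
  case (Suc k)
  then have k: "k < k0" and ad: "krylov_adapted x k"
    by auto
  have "\<exists>y. x (Suc k) = q y \<and> y - x0 \<in> K k \<and> (k = 0 \<or> y - x0 \<notin> K (k - 1))"
  proof (cases "k mod (1 + t) < t")
    case True
    then have "x (Suc k) = q (x k)"
      using assms(1) by (simp add: aAA_FP_iterates_def)
    moreover have "k = 0 \<or> x k - x0 \<notin> K (k - 1)"
      using ad by (cases k) (auto simp: krylov_adapted_def)
    ultimately show ?thesis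
      using ad by (auto simp: krylov_adapted_def)
  next
    case False
    then have "anderson_step q \<infinity> x k (x (Suc k))"
      using assms(1) by (simp add: aAA_FP_iterates_def)
    then have "x (Suc k) = q (xG k)"
      using anderson_step_gmres[OF ad] k by simp
    moreover have "k = 0 \<or> xG k - x0 \<notin> K (k - 1)"
      using gmres_notin[of "k - 1"] k by (cases k) auto
    ultimately show ?thesis
      using gmres_in by blast
  qed
  then have "x (Suc k) - x0 \<in> K (Suc k) \<and> x (Suc k) - x0 \<notin> K k"
    using q_fresh[OF k] by metis
  with ad show ?case
    by (auto simp: krylov_adapted_def le_Suc_eq less_Suc_eq)
qed

text \<open>Residue \<open>t\<close> is the only Anderson slot in a cycle of length
  \<open>1 + t\<close>.\<close>

lemma iterates_gmres:
  assumes "aAA_FP_iterates q \<infinity> 1 t x0 x" "k \<le> k0" "k mod (1 + t) = t"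
  shows "x (Suc k) = q (xG k)"
proof (rule anderson_step_gmres)
  show "krylov_adapted x k"
    using assms(1,2) by (rule iterates_krylov_adapted)
  show "anderson_step q \<infinity> x k (x (Suc k))"
    using assms(1,3) unfolding aAA_FP_iterates_def by (metis less_irrefl)
qed (fact assms(2))

end

theorem theorem1:
  fixes A M :: "real^'n^'n" and b xstar x0 :: "real^'n"
    and q :: "real^'n \<Rightarrow> real^'n"
    and x xG :: "nat \<Rightarrow> real^'n"
    and t p k0 :: nat
  assumes "A *v xstar = b"
    and "M = mat 1 - A"
    and "q = (\<lambda>y. M *v y + b)"
    and "p = t + 1"
    and "aAA_FP_iterates q \<infinity> 1 t x0 x"
    and "gmres_iterates A b x0 xG"
    and "\<forall>k. 1 \<le> k \<and> k \<le> k0 \<longrightarrow> norm (b - A *v xG k) < norm (b - A *v xG (k - 1))"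
  shows "\<forall>j. 1 \<le> j \<and> j * p < k0 \<longrightarrow> x (j * p) = q (xG (j * p - 1))"
proof (intro allI impI)
  interpret G: gmres_decreasing A b x0 xG k0
  proof
    show "norm (b - A *v xG (Suc k)) < norm (b - A *v xG k)" if "k < k0" for k
      using assms(7)[rule_format, of "Suc k"] that by simp
  qed (fact assms(6))
  have q: "q = G.q"
    unfolding assms(2,3) G.q_def by (rule refl)
  fix j assume j: "1 \<le> j \<and> j * p < k0"
  define k where "k = j * p - 1"
  obtain l where l: "j = Suc l"
    using j by (cases j) auto
  \<comment> \<open>The last index of the cycle numbered \<open>l\<close> from zero;
    \<open>j\<close> being positive keeps the truncated subtraction in \<open>k\<close>
    exact.\<close>
  then have "k = t + l * (1 + t)"
    by (simp add: k_def assms(4))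
  then have "k mod (1 + t) = t"
    by (metis mod_mult_self1 mod_less less_add_same_cancel2 zero_less_one)
  moreover have "Suc k = j * p" "k \<le> k0"
    using j l assms(4) by (auto simp: k_def)
  ultimately show "x (j * p) = q (xG (j * p - 1))"
    using G.iterates_gmres assms(5) unfolding q k_def by metis
qed

end
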